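(* Let $m,n$ be positive integers and let $S_j \subset \mathbb{R}$, $j=1,2,\ldots,m$, be convex subsets of the real line. Let $f: S_1\times S_2\times\cdots\times S_m\rightarrow\mathbb{R}$ be a function of class $\mathcal{C}^0$. If $f$ is convex (resp. concave) in $S_1\times\cdots\times S_m$, then $\mathrm{Tr}\circ f$ is convex (resp. concave) in $\mathcal{M}_{\mathrm{herm}^n}(S_1)\times\cdots\times\mathcal{M}_{\mathrm{herm}^n}(S_m)$. That is, for any $\alpha\in[0,1]$ and any $(M_1,\ldots,M_m),(N_1,\ldots,N_m)\in\mathcal{M}_{\mathrm{herm}^n}(S_1)\times\cdots\times\mathcal{M}_{\mathrm{herm}^n}(S_m)$, $$\mathrm{Tr}\left(f(\alpha M_1+(1-\alpha)N_1,\ldots,\alpha M_m+(1-\alpha)N_m)\right)\leq \alpha\,\mathrm{Tr}\left(f(M_1,\ldots,M_m)\right)+(1-\alpha)\,\mathrm{Tr}\left(f(N_1,\ldots,N_m)\right)$$ when $f$ is convex (resp. $\geq$ when $f$ is concave).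
   Context: For $S\subseteq\mathbb{R}$, $\mathcal{M}_{\mathrm{herm}^n}(S)$ is the set of $n\times n$ (complex) Hermitian matrices all of whose eigenvalues lie in $S$; it is a convex set when $S$ is convex. Extension of $f$ to matrices: for diagonalizable $n\times n$ matrices $M_j = P_j\,\mathrm{diag}(\lambda_{j1},\ldots,\lambda_{jn})P_j^{-1}$ with all eigenvalues $\lambda_{jk}\in S_j$, $j=1,\ldots,m$, the matrix $f(M_1,\ldots,M_m)\in\mathbb{C}^{n^m\times n^m}$ is $$f(M_1,\ldots,M_m)=\Big(\bigotimes_{j=1}^m P_j\Big)\,\mathrm{diag}_{j_1,\ldots,j_m}\big(f(\lambda_{1j_1},\ldots,\lambda_{mj_m})\big)\,\Big(\bigotimes_{j=1}^m P_j^{-1}\Big),$$ where $\otimes$ is the Kronecker product and the diagonal matrix has its $n^m$ entries indexed by $(j_1,\ldots,j_m)\in\{1,\ldots,n\}^m$ in lexicographic order. Hence $(\mathrm{Tr}\circ f)(M_1,\ldots,M_m)=\mathrm{Tr}(f(M_1,\ldots,M_m))=\sum_{j_1,\ldots,j_m=1}^n f(\lambda_{1j_1},\ldots,\lambda_{mj_m})$. Convexity of $f$ means (joint) convexity as a scalar function on the convex set $S_1\times\cdots\times S_m\subseteq\mathbb{R}^m$. *)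

theory Defs
  imports "HOL-Analysis.Analysis" "Jordan_Normal_Form.Schur_Decomposition"
begin

no_notation Matrix.vec_index (infixl "$" 100)

(* The number m of arguments is CARD('m) for a finite, linearly ordered, otherwise arbitrary
   index type 'm; the order on 'm fixes the order of the Kronecker factors.  Matrices have a
   variable dimension n and, like all indices below, are 0-based. *)

definition set_prod :: "('m::finite \<Rightarrow> real set) \<Rightarrow> (real ^ 'm) set" where
  "set_prod S = {x. \<forall>j. x $ j \<in> S j}"

definition hermitian :: "complex mat \<Rightarrow> bool" where
  "hermitian A \<longleftrightarrow> square_mat A \<and> mat_adjoint A = A"

definition M_herm :: "nat \<Rightarrow> real set \<Rightarrow> complex mat set" where
  "M_herm n S =
    {A \<in> carrier_mat n n. hermitian A \<and> (\<forall>c. eigenvalue A c \<longrightarrow> c \<in> complex_of_real ` S)}"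

(* Traces are complex numbers and are compared by the order of HOL-Library.Complex_Order
   (equal imaginary parts, ordered real parts), which on real traces is the usual order. *)
definition mat_trace :: "'a::comm_monoid_add mat \<Rightarrow> 'a" where
  "mat_trace A = (\<Sum>i<dim_row A. A $$ (i, i))"

definition kronecker :: "'a::times mat \<Rightarrow> 'a mat \<Rightarrow> 'a mat" where
  "kronecker A B = Matrix.mat (dim_row A * dim_row B) (dim_col A * dim_col B)
     (\<lambda>(i, j). A $$ (i div dim_row B, j div dim_col B) * B $$ (i mod dim_row B, j mod dim_col B))"

definition kronecker_family :: "('m::{finite,linorder} \<Rightarrow> 'a::semiring_1 mat) \<Rightarrow> 'a mat" where
  "kronecker_family P = foldr kronecker (map P (sorted_list_of_set UNIV)) (1\<^sub>m 1)"

(* The k-th multi-index (k < n ^ CARD('m)) in lexicographic order: the base-n digits of k, the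
   least index of 'm carrying the most significant digit. *)
definition lex_index :: "nat \<Rightarrow> nat \<Rightarrow> 'm::{finite,linorder} \<Rightarrow> nat" where
  "lex_index n k j = (k div n ^ card {i. j < i}) mod n"

(* X is a value of f (M_1, ..., M_m), computed from diagonalizations
   M_j = P_j diag(l_j0, ..., l_j(n-1)) Q_j with Q_j the inverse of P_j.  The eigenvalues of M_j
   are the l_jk, so for eigenvalues in S_j only values of f on set_prod S enter. *)
definition is_matrix_ext ::
  "nat \<Rightarrow> (real ^ 'm::{finite,linorder} \<Rightarrow> real) \<Rightarrow> ('m \<Rightarrow> complex mat) \<Rightarrow> complex mat \<Rightarrow> bool" where
  "is_matrix_ext n f M X \<longleftrightarrow>
    (\<exists>P Q l. (\<forall>j. M j \<in> carrier_mat n n \<and>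
                  similar_mat_wit (M j) (mat_diag n (\<lambda>k. complex_of_real (l j k))) (P j) (Q j)) \<and>
       X = kronecker_family P
           * mat_diag (n ^ CARD('m)) (\<lambda>k. complex_of_real (f (\<chi> j. l j (lex_index n k j))))
           * kronecker_family Q)"

(* The value does not depend on the chosen diagonalizations; without real diagonalizations
   the value is unspecified. *)
definition matrix_ext ::
  "nat \<Rightarrow> (real ^ 'm::{finite,linorder} \<Rightarrow> real) \<Rightarrow> ('m \<Rightarrow> complex mat) \<Rightarrow> complex mat" where
  "matrix_ext n f M = (SOME X. is_matrix_ext n f M X)"

end

theory Submission
  imports Defs
begin

text \<open>
  The trace of \<open>f (M_1, ..., M_m)\<close> is the sum of \<open>f\<close> over all choices \<open>i\<close> of one eigenvalue of each
  matrix (lemma \<open>mat_trace_matrix_ext\<close>): the Kronecker products of the \<open>P j\<close> and of their inverses are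
  inverse to each other, so they cancel under the trace, and the lexicographic digits run through
  all multi-indices once. The eigenvalue multiset is determined by the characteristic polynomial,
  hence any diagonalizations give the same sum, and for Hermitian matrices they may be taken unitary.

  Let \<open>A j = \<alpha> M j + (1 - \<alpha>) N j\<close> have the orthonormal eigenbasis \<open>U j\<close> and eigenvalues \<open>a j k\<close>.
  Reading the diagonal of \<open>A j\<close> in the basis \<open>U j\<close> (lemma \<open>eigenvalues_of_combination\<close>) gives
  \<open>a j k = \<alpha> b j k + (1 - \<alpha>) c j k\<close>, where \<open>b j\<close> and \<open>c j\<close> arise from the eigenvalues of \<open>M j\<close> and
  \<open>N j\<close> by averaging with doubly stochastic matrices, namely the squared moduli of the entries of the
  change of basis. Convexity of \<open>f\<close> bounds the sum over the \<open>a\<close> by the combination of the sums over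
  the \<open>b\<close> and over the \<open>c\<close>. Finally the averages are removed one function value at a time
  (lemma \<open>sum_doubly_stochastic_le\<close>): the products over \<open>j\<close> of the entries of the doubly stochastic
  matrices form a doubly stochastic matrix on multi-indices, and Jensen's inequality applies to each
  of its rows, while its column sums, being one, restore the plain sum. The concave case is the
  convex case for \<open>- f\<close>.
\<close>

section \<open>Adjoints and unitary matrices\<close>

lemma mat_adjoint_carrier: "A \<in> carrier_mat n m \<Longrightarrow> mat_adjoint A \<in> carrier_mat m n"
  unfolding mat_adjoint_def by (auto simp: mat_of_rows_def)

lemma mat_adjoint_index:
  "A \<in> carrier_mat n m \<Longrightarrow> i < m \<Longrightarrow> j < n \<Longrightarrow> mat_adjoint A $$ (i, j) = conjugate (A $$ (j, i))"
  unfolding mat_adjoint_def by (auto simp: mat_of_rows_def)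

lemma mat_mult_index:
  "A \<in> carrier_mat n k \<Longrightarrow> B \<in> carrier_mat k m \<Longrightarrow> i < n \<Longrightarrow> j < m \<Longrightarrow>
     (A * B) $$ (i, j) = (\<Sum>p<k. A $$ (i, p) * B $$ (p, j))"
  by (auto simp: scalar_prod_def lessThan_atLeast0 intro!: sum.cong)

lemma mat_adjoint_mult:
  fixes A B :: "complex mat"
  assumes A: "A \<in> carrier_mat n k" and B: "B \<in> carrier_mat k m"
  shows "mat_adjoint (A * B) = mat_adjoint B * mat_adjoint A"
proof (rule eq_matI)
  note c = mat_adjoint_carrier[OF A] mat_adjoint_carrier[OF B] mult_carrier_mat[OF A B]
  fix i j assume ij: "i < dim_row (mat_adjoint B * mat_adjoint A)"
    "j < dim_col (mat_adjoint B * mat_adjoint A)"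
  then have ij: "i < m" "j < n" using c by auto
  show "mat_adjoint (A * B) $$ (i, j) = (mat_adjoint B * mat_adjoint A) $$ (i, j)"
    unfolding mat_adjoint_index[OF c(3) ij] mat_mult_index[OF c(2,1) ij]
      mat_mult_index[OF A B ij(2,1)]
    by (auto simp: mat_adjoint_index[OF A] mat_adjoint_index[OF B] ij mult.commute intro!: sum.cong)
qed (use mat_adjoint_carrier[OF A] mat_adjoint_carrier[OF B]
      mat_adjoint_carrier[OF mult_carrier_mat[OF A B]] in auto)

lemma mat_adjoint_adjoint:
  fixes A :: "complex mat"
  assumes A: "A \<in> carrier_mat n m"
  shows "mat_adjoint (mat_adjoint A) = A"
  using A mat_adjoint_carrier[OF A] mat_adjoint_carrier[OF mat_adjoint_carrier[OF A]]
  by (intro eq_matI) (auto simp: mat_adjoint_index[OF mat_adjoint_carrier[OF A]] mat_adjoint_index[OF A])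

definition unitary :: "nat \<Rightarrow> complex mat \<Rightarrow> bool" where
  "unitary n U \<longleftrightarrow> U \<in> carrier_mat n n \<and> mat_adjoint U * U = 1\<^sub>m n"

lemma unitaryD:
  assumes "unitary n U"
  shows "U \<in> carrier_mat n n" "mat_adjoint U \<in> carrier_mat n n"
    "mat_adjoint U * U = 1\<^sub>m n" "U * mat_adjoint U = 1\<^sub>m n"
  using assms mat_adjoint_carrier[of U n n]
    mat_mult_left_right_inverse[of "mat_adjoint U" n U]
  unfolding unitary_def by auto

lemma unitary_mult:
  assumes "unitary n U" "unitary n V"
  shows "unitary n (U * V)"
proof -
  note u = unitaryD[OF assms(1)] and v = unitaryD[OF assms(2)]
  have "mat_adjoint (U * V) * (U * V) = mat_adjoint V * (mat_adjoint U * U) * V"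
    using u(1,2) v(1,2) by (simp add: mat_adjoint_mult[OF u(1) v(1)] assoc_mult_mat[of _ n n _ n _ n])
  then show ?thesis
    using u v by (simp add: unitary_def)
qed

lemma unitary_adjoint:
  assumes "unitary n U" shows "unitary n (mat_adjoint U)"
  using unitaryD[OF assms] by (auto simp: unitary_def mat_adjoint_adjoint[of U n n])

text \<open>
  Gram-Schmidt, applied to a basis that starts with \<open>v\<close>, leaves \<open>v\<close> in place; it only produces an
  orthogonal family, so the columns are normalized afterwards. That is where the factor \<open>c\<close> comes
  from.
\<close>

lemma unitary_with_first_column:
  assumes v: "v \<in> carrier_vec n" and v0: "v \<noteq> 0\<^sub>v n"
  obtains U c where "unitary n U" and "col U 0 = c \<cdot>\<^sub>v v"
proof -
  interpret cof_vec_space n "TYPE(complex)" .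
  have n: "n > 0" using v v0 by (cases n) auto
  define b where "b = basis_completion v"
  define ws where "ws = gram_schmidt n b"
  from basis_completion[OF v v0, folded b_def]
  have "distinct b" "\<not> lin_dep (set b)" and b: "set b \<subseteq> carrier_vec n" and hdb: "hd b = v"
    and len_b: "length b = n" by auto
  from hdb len_b n obtain vs where bv: "b = v # vs" by (cases b, auto)
  from gram_schmidt_result[OF b \<open>distinct b\<close> \<open>\<not> lin_dep (set b)\<close> refl, folded ws_def]
  have ws: "set ws \<subseteq> carrier_vec n" "corthogonal ws" "length ws = n"
    by (auto simp: len_b)
  have hdws: "ws ! 0 = v"
    using gram_schmidt_hd[OF v, of vs, folded bv] ws n by (cases ws) (auto simp: ws_def)
  have wsc: "ws ! i \<in> carrier_vec n" if "i < n" for i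
    using that ws by auto
  \<comment> \<open>The squared length of the column, as a real number, so that its root can be taken.\<close>
  define N where "N i = (\<Sum>p<n. (cmod (vec_index (ws ! i) p))\<^sup>2)" for i
  have inner: "ws ! j \<bullet>c ws ! i = (\<Sum>p<n. cnj (vec_index (ws ! i) p) * vec_index (ws ! j) p)"
    if "i < n" "j < n" for i j
    using wsc[OF that(1)] wsc[OF that(2)]
    by (auto simp: scalar_prod_def lessThan_atLeast0 mult.commute intro!: sum.cong)
  have N: "complex_of_real (N i) = ws ! i \<bullet>c ws ! i" if "i < n" for i
    unfolding inner[OF that that] N_def
    by (simp add: complex_norm_square mult.commute flip: of_real_power)
  have N0: "N i > 0" if "i < n" for i
  proof -
    have "N i \<noteq> 0" using N[OF that] corthogonalD[OF ws(2), of i i] that ws by auto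
    then show ?thesis unfolding N_def by (metis less_eq_real_def sum_nonneg zero_le_power2)
  qed
  define U where "U = Matrix.mat n n (\<lambda>(i, j). vec_index (ws ! j) i / complex_of_real (sqrt (N j)))"
  have U: "U \<in> carrier_mat n n" by (simp add: U_def)
  have Uij: "U $$ (i, j) = vec_index (ws ! j) i / complex_of_real (sqrt (N j))"
    if "i < n" "j < n" for i j
    using that by (simp add: U_def)
  have "mat_adjoint U * U = 1\<^sub>m n"
  proof (rule eq_matI)
    fix i j assume "i < dim_row (1\<^sub>m n :: complex mat)" "j < dim_col (1\<^sub>m n :: complex mat)"
    then have ij: "i < n" "j < n" by auto
    have "(mat_adjoint U * U) $$ (i, j) =
      (\<Sum>p<n. cnj (vec_index (ws ! i) p) * vec_index (ws ! j) p) / complex_of_real (sqrt (N i) * sqrt (N j))"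
      unfolding mat_mult_index[OF mat_adjoint_carrier[OF U] U ij] sum_divide_distrib
      using ij by (auto simp: mat_adjoint_index[OF U] Uij intro!: sum.cong)
    also have "\<dots> = (ws ! j \<bullet>c ws ! i) / complex_of_real (sqrt (N i) * sqrt (N j))"
      by (simp add: inner ij)
    also have "\<dots> = (if i = j then 1 else 0)"
      using N[OF ij(1)] N0[OF ij(1)] corthogonalD[OF ws(2), of j i] ij ws
      by (auto simp flip: of_real_divide of_real_mult)
    finally show "(mat_adjoint U * U) $$ (i, j) = 1\<^sub>m n $$ (i, j)" using ij by simp
  qed (use U mat_adjoint_carrier[OF U] in auto)
  then have "unitary n U" using U by (simp add: unitary_def)
  moreover have "col U 0 = (1 / complex_of_real (sqrt (N 0))) \<cdot>\<^sub>v v"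
    using v n by (intro eq_vecI) (auto simp: U_def hdws)
  ultimately show ?thesis by (rule that)
qed

section \<open>Unitary diagonalization of Hermitian matrices\<close>

lemma hermitianD:
  assumes "hermitian A" "A \<in> carrier_mat n n" "i < n" "j < n"
  shows "A $$ (i, j) = cnj (A $$ (j, i))"
  using assms mat_adjoint_index[of A n n i j] by (simp add: hermitian_def)

definition diagonalizes :: "nat \<Rightarrow> complex mat \<Rightarrow> complex mat \<Rightarrow> (nat \<Rightarrow> real) \<Rightarrow> bool" where
  "diagonalizes n A U l \<longleftrightarrow>
     unitary n U \<and> A = U * mat_diag n (\<lambda>k. complex_of_real (l k)) * mat_adjoint U"

text \<open>
  Induction on the size. Conjugating \<open>A\<close> with a unitary matrix whose first column is an eigenvector
  makes the first column a multiple of the first unit vector; as conjugation keeps the matrix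
  Hermitian, the first row is so too and the eigenvalue is real. What remains is a smaller Hermitian
  block.
\<close>

lemma hermitian_diagonalizable:
  assumes "A \<in> carrier_mat n n" "hermitian A"
  obtains U l where "diagonalizes n A U l"
proof -
  have "\<exists>U l. unitary n U \<and> A = U * mat_diag n (\<lambda>k. complex_of_real (l k)) * mat_adjoint U"
    using assms
  proof (induction n arbitrary: A)
    case 0
    have "unitary 0 (1\<^sub>m 0)"
      using mat_adjoint_carrier[of "1\<^sub>m 0 :: complex mat" 0 0]
      by (auto simp: unitary_def intro!: eq_matI)
    moreover have "A = 1\<^sub>m 0 * mat_diag 0 (\<lambda>k. complex_of_real ((\<lambda>_. 0) k)) * mat_adjoint (1\<^sub>m 0)"
      using 0 mat_adjoint_carrier[of "1\<^sub>m 0 :: complex mat" 0 0] by (auto intro!: eq_matI)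
    ultimately show ?case by (intro exI conjI)
  next
    case (Suc n)
    let ?N = "Suc n"
    note A = Suc.prems(1)
    obtain as where as: "char_poly A = (\<Prod>a\<leftarrow>as. [:- a, 1:])" "length as = ?N"
      using char_poly_factorized[OF A] by auto
    then obtain e where "poly (char_poly A) e = 0" by (cases as) auto
    then obtain v where v: "v \<in> carrier_vec ?N" "v \<noteq> 0\<^sub>v ?N" "A *\<^sub>v v = e \<cdot>\<^sub>v v"
      using A eigenvalue_root_char_poly[OF A] by (auto simp: eigenvalue_def eigenvector_def)
    obtain U c where U: "unitary ?N U" and c: "col U 0 = c \<cdot>\<^sub>v v"
      using unitary_with_first_column[OF v(1,2)] .
    note U' = unitaryD[OF U]
    define B where "B = mat_adjoint U * A * U"
    have B: "B \<in> carrier_mat ?N ?N" using U' A by (auto simp: B_def)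
    have A_eq: "A = U * B * mat_adjoint U"
    proof -
      have "U * B * mat_adjoint U = (U * mat_adjoint U) * A * (U * mat_adjoint U)"
        unfolding B_def using U'(1,2) A by (simp add: assoc_mult_mat[of _ ?N ?N _ ?N _ ?N])
      then show ?thesis using U' A by simp
    qed
    have hB: "mat_adjoint B = B"
      unfolding B_def using U'(1,2) A Suc.prems(2)
      by (simp add: mat_adjoint_mult[of _ ?N ?N _ ?N] mat_adjoint_adjoint[of U ?N ?N] hermitian_def
          assoc_mult_mat[of _ ?N ?N _ ?N _ ?N])
    then have herm_B: "hermitian B" using B by (simp add: hermitian_def)
    have "B = mat_adjoint U * (A * U)"
      unfolding B_def using U'(1,2) A by (simp add: assoc_mult_mat[of _ ?N ?N _ ?N _ ?N])
    then have "col B 0 = mat_adjoint U *\<^sub>v (A *\<^sub>v col U 0)"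
      using col_mult2[OF U'(2) mult_carrier_mat[OF A U'(1)], of 0] col_mult2[OF A U'(1), of 0] by simp
    also have "A *\<^sub>v col U 0 = e \<cdot>\<^sub>v col U 0"
      unfolding c using A v by (simp add: mult_mat_vec[of _ ?N ?N] smult_smult_assoc mult.commute)
    also have "mat_adjoint U *\<^sub>v (e \<cdot>\<^sub>v col U 0) = e \<cdot>\<^sub>v col (mat_adjoint U * U) 0"
      using mult_mat_vec[OF U'(2) col_carrier_vec[OF _ U'(1)], of 0 e] col_mult2[OF U'(2,1), of 0] by simp
    finally have colB: "col B 0 = e \<cdot>\<^sub>v unit_vec ?N 0" using U'(3) by simp
    have B0: "B $$ (i, 0) = (if i = 0 then e else 0)" if "i < ?N" for i
      using arg_cong[OF colB, of "\<lambda>v. vec_index v i"] B that by auto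
    have B0': "B $$ (0, i) = (if i = 0 then e else 0)" if "i < ?N" for i
      using hermitianD[OF herm_B B, of 0 i] B0[of i] B0[of 0] that by auto
    have e: "complex_of_real (Re e) = e"
      using hermitianD[OF herm_B B, of 0 0] B0[of 0] by (auto simp: complex_eq_iff)
    define C where "C = Matrix.mat n n (\<lambda>(i, j). B $$ (Suc i, Suc j))"
    have C: "C \<in> carrier_mat n n" by (simp add: C_def)
    have Cij: "C $$ (i, j) = B $$ (Suc i, Suc j)" if "i < n" "j < n" for i j
      using that by (simp add: C_def)
    have "mat_adjoint C = C"
      using C mat_adjoint_carrier[OF C]
      by (intro eq_matI)
        (auto simp: mat_adjoint_index[OF C] Cij hermitianD[OF herm_B B, symmetric])
    then have "hermitian C" using C by (simp add: hermitian_def)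
    with Suc.IH[OF C] obtain V l where V: "unitary n V"
      and C_eq: "C = V * mat_diag n (\<lambda>k. complex_of_real (l k)) * mat_adjoint V" by blast
    note V' = unitaryD[OF V]
    \<comment> \<open>The eigenvalue \<open>e\<close> is a scalar block of its own, so the diagonalization of \<open>C\<close> carries over
        to \<open>B\<close> block by block.\<close>
    let ?blk = "\<lambda>x X. four_block_mat (x \<cdot>\<^sub>m 1\<^sub>m 1) (0\<^sub>m 1 n) (0\<^sub>m n 1) X :: complex mat"
    have blk_carrier: "?blk x X \<in> carrier_mat ?N ?N" if "X \<in> carrier_mat n n" for x X
      using four_block_carrier_mat[OF _ that, of "x \<cdot>\<^sub>m 1\<^sub>m 1" 1 1] by simp
    define R where "R = ?blk 1 V"
    define l' where "l' k = (if k = 0 then Re e else l (k - 1))" for k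
    let ?D = "mat_diag ?N (\<lambda>k. complex_of_real (l' k))"
    have R: "R \<in> carrier_mat ?N ?N" unfolding R_def by (rule blk_carrier[OF V'(1)])
    have blk_mult: "?blk x X * ?blk y Y = ?blk (x * y) (X * Y)"
      if "X \<in> carrier_mat n n" "Y \<in> carrier_mat n n" for x y X Y
      using that by (subst mult_four_block_mat[of _ 1 1 _ n _ n _ _ 1 _ n])
        (auto intro!: cong_four_block_mat eq_matI simp: scalar_prod_def)
    have adj_R: "mat_adjoint R = ?blk 1 (mat_adjoint V)"
    proof (rule eq_matI)
      show "dim_row (mat_adjoint R) = dim_row (?blk 1 (mat_adjoint V))"
        "dim_col (mat_adjoint R) = dim_col (?blk 1 (mat_adjoint V))"
        using mat_adjoint_carrier[OF R] blk_carrier[OF V'(2), of 1]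
        by (auto simp only: carrier_matD)
      fix i j assume "i < dim_row (?blk 1 (mat_adjoint V))" "j < dim_col (?blk 1 (mat_adjoint V))"
      then have ij: "i < ?N" "j < ?N" using V'(2) by auto
      show "mat_adjoint R $$ (i, j) = ?blk 1 (mat_adjoint V) $$ (i, j)"
        unfolding mat_adjoint_index[OF R ij] using ij V'(1,2)
        by (auto simp: R_def mat_adjoint_index[OF V'(1)])
    qed
    have "mat_adjoint R * R = 1\<^sub>m ?N"
      unfolding adj_R unfolding R_def blk_mult[OF V'(2,1)] V'(3) by (intro eq_matI) auto
    then have uR: "unitary ?N R" using R by (simp add: unitary_def)
    define D where "D = ?D"
    have D: "D \<in> carrier_mat ?N ?N" by (simp add: D_def)
    have D_blk: "D = ?blk e (mat_diag n (\<lambda>k. complex_of_real (l k)))"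
      unfolding D_def using e by (intro eq_matI) (auto simp: mat_diag_def l'_def)
    have "R * D * mat_adjoint R = ?blk e C"
      unfolding adj_R unfolding R_def D_blk C_eq blk_mult[OF V'(1) mat_diag_dim]
        blk_mult[OF mult_carrier_mat[OF V'(1) mat_diag_dim] V'(2)] by simp
    also have "\<dots> = B"
      using B C by (intro eq_matI) (auto simp: C_def B0 B0')
    finally have "A = U * (R * D * mat_adjoint R) * mat_adjoint U" using A_eq by simp
    also have "\<dots> = (U * R) * D * mat_adjoint (U * R)"
      using U'(1,2) R D mat_adjoint_carrier[OF R]
      by (simp add: mat_adjoint_mult[of _ ?N ?N _ ?N] assoc_mult_mat[of _ ?N ?N _ ?N _ ?N])
    finally have "A = (U * R) * ?D * mat_adjoint (U * R)" unfolding D_def .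
    with unitary_mult[OF U uR] show ?case by blast
  qed
  then show ?thesis using that unfolding diagonalizes_def by blast
qed

lemma diagonalizes_carrier: "diagonalizes n A U l \<Longrightarrow> A \<in> carrier_mat n n"
  using unitaryD(1,2)[of n U] mult_carrier_mat[OF mult_carrier_mat[OF _ mat_diag_dim]]
  unfolding diagonalizes_def by blast

lemma diagonalizes_similar:
  assumes "diagonalizes n A U l"
  shows "similar_mat_wit A (mat_diag n (\<lambda>k. complex_of_real (l k))) U (mat_adjoint U)"
proof -
  have U: "unitary n U" and A: "A = U * mat_diag n (\<lambda>k. complex_of_real (l k)) * mat_adjoint U"
    using assms by (auto simp: diagonalizes_def)
  show ?thesis
    using unitaryD[OF U] diagonalizes_carrier[OF assms] by (intro similar_mat_witI[OF _ _ A]) auto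
qed

section \<open>The trace of a matrix function of several matrices\<close>

lemma sum_div_mod:
  fixes g :: "nat \<Rightarrow> nat \<Rightarrow> 'a::comm_monoid_add"
  shows "(\<Sum>p<k * m. g (p div m) (p mod m)) = (\<Sum>q<k. \<Sum>r<m. g q r)"
proof -
  have "(\<Sum>p<k * m. g (p div m) (p mod m)) = (\<Sum>(q, r)\<in>{..<k} \<times> {..<m}. g q r)"
  proof (rule sum.reindex_bij_witness[of _ "\<lambda>(q, r). q * m + r" "\<lambda>p. (p div m, p mod m)"])
    fix p assume "p \<in> {..<k * m}"
    then show "(p div m, p mod m) \<in> {..<k} \<times> {..<m}"
      by (cases "m = 0") (auto simp: less_mult_imp_div_less)
  next
    fix a assume "a \<in> {..<k} \<times> {..<m}"
    then obtain q r where a: "a = (q, r)" "q < k" "r < m" by auto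
    have "q * m + r < Suc q * m" using a by simp
    also have "\<dots> \<le> k * m" using a by (intro mult_le_mono1) auto
    finally show "(case a of (q, r) \<Rightarrow> q * m + r) \<in> {..<k * m}" using a by simp
  qed auto
  then show ?thesis by (simp add: sum.cartesian_product)
qed

lemma kronecker_carrier:
  "A \<in> carrier_mat a b \<Longrightarrow> B \<in> carrier_mat c d \<Longrightarrow> kronecker A B \<in> carrier_mat (a * c) (b * d)"
  by (simp add: kronecker_def)

lemma kronecker_index:
  "A \<in> carrier_mat a b \<Longrightarrow> B \<in> carrier_mat c d \<Longrightarrow> i < a * c \<Longrightarrow> j < b * d \<Longrightarrow>
    kronecker A B $$ (i, j) = A $$ (i div c, j div d) * B $$ (i mod c, j mod d)"
  by (auto simp: kronecker_def)

text \<open>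
  The mixed product rule: with quotient and remainder as row and column indices of the two factors,
  the inner sum of the matrix product splits into a product of two sums.
\<close>

lemma kronecker_mult:
  fixes A B C D :: "'a::comm_semiring_1 mat"
  assumes A: "A \<in> carrier_mat a k" and B: "B \<in> carrier_mat b l"
    and C: "C \<in> carrier_mat k c" and D: "D \<in> carrier_mat l d"
  shows "kronecker A B * kronecker C D = kronecker (A * C) (B * D)"
proof (rule eq_matI)
  note AB = kronecker_carrier[OF A B] and CD = kronecker_carrier[OF C D]
  note R = kronecker_carrier[OF mult_carrier_mat[OF A C] mult_carrier_mat[OF B D]]
  fix i j assume "i < dim_row (kronecker (A * C) (B * D))" "j < dim_col (kronecker (A * C) (B * D))"
  then have ij: "i < a * b" "j < c * d" using R by auto
  then have "b > 0" "d > 0" by (auto intro!: Nat.gr0I)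
  then have dm: "i div b < a" "i mod b < b" "j div d < c" "j mod d < d"
    using ij by (auto simp: less_mult_imp_div_less)
  have "(kronecker A B * kronecker C D) $$ (i, j) =
      (\<Sum>p<k * l. (A $$ (i div b, p div l) * B $$ (i mod b, p mod l)) *
          (C $$ (p div l, j div d) * D $$ (p mod l, j mod d)))"
    unfolding mat_mult_index[OF AB CD ij]
    by (intro sum.cong refl) (simp add: kronecker_index[OF A B] kronecker_index[OF C D] ij)
  also have "\<dots> = (\<Sum>q<k. \<Sum>r<l. (A $$ (i div b, q) * B $$ (i mod b, r)) *
          (C $$ (q, j div d) * D $$ (r, j mod d)))"
    by (rule sum_div_mod)
  also have "\<dots> = (\<Sum>q<k. A $$ (i div b, q) * C $$ (q, j div d)) *
      (\<Sum>r<l. B $$ (i mod b, r) * D $$ (r, j mod d))"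
    unfolding sum_product by (intro sum.cong refl) (simp add: ac_simps)
  also have "\<dots> = kronecker (A * C) (B * D) $$ (i, j)"
    unfolding kronecker_index[OF mult_carrier_mat[OF A C] mult_carrier_mat[OF B D] ij]
      mat_mult_index[OF A C dm(1,3)] mat_mult_index[OF B D dm(2,4)] ..
  finally show "(kronecker A B * kronecker C D) $$ (i, j) = kronecker (A * C) (B * D) $$ (i, j)" .
qed (use kronecker_carrier[OF A B] kronecker_carrier[OF C D]
    kronecker_carrier[OF mult_carrier_mat[OF A C] mult_carrier_mat[OF B D]] in auto)

lemma kronecker_one: "kronecker (1\<^sub>m a) (1\<^sub>m b) = (1\<^sub>m (a * b) :: 'a::semiring_1 mat)"
proof (rule eq_matI)
  fix i j assume "i < dim_row (1\<^sub>m (a * b) :: 'a mat)" "j < dim_col (1\<^sub>m (a * b) :: 'a mat)"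
  then have ij: "i < a * b" "j < a * b" by auto
  then have "b > 0" by (auto intro!: Nat.gr0I)
  then have dm: "i div b < a" "i mod b < b" "j div b < a" "j mod b < b"
    using ij by (auto simp: less_mult_imp_div_less)
  have "i = j \<longleftrightarrow> i div b = j div b \<and> i mod b = j mod b"
    by (metis div_mult_mod_eq)
  then show "kronecker (1\<^sub>m a) (1\<^sub>m b) $$ (i, j) = (1\<^sub>m (a * b) :: 'a mat) $$ (i, j)"
    using ij dm by (auto simp: kronecker_index[OF one_carrier_mat one_carrier_mat])
qed (auto simp: kronecker_def)

lemma foldr_kronecker_carrier:
  fixes P :: "'b \<Rightarrow> 'a::semiring_1 mat"
  assumes "\<And>x. P x \<in> carrier_mat n n"
  shows "foldr kronecker (map P xs) (1\<^sub>m 1) \<in> carrier_mat (n ^ length xs) (n ^ length xs)"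
  by (induction xs) (auto intro!: kronecker_carrier assms)

lemma foldr_kronecker_inverse:
  fixes P Q :: "'b \<Rightarrow> 'a::comm_semiring_1 mat"
  assumes P: "\<And>x. P x \<in> carrier_mat n n" and Q: "\<And>x. Q x \<in> carrier_mat n n"
    and QP: "\<And>x. Q x * P x = 1\<^sub>m n"
  shows "foldr kronecker (map Q xs) (1\<^sub>m 1) * foldr kronecker (map P xs) (1\<^sub>m 1) = 1\<^sub>m (n ^ length xs)"
proof (induction xs)
  case (Cons x xs)
  then show ?case
    using kronecker_mult[OF Q[of x] foldr_kronecker_carrier[of Q, OF Q, of xs]
        P[of x] foldr_kronecker_carrier[of P, OF P, of xs]]
    by (simp add: QP kronecker_one)
qed simp

lemma kronecker_family_carrier:
  fixes P :: "'m::{finite,linorder} \<Rightarrow> 'a::comm_semiring_1 mat"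
  assumes "\<And>j. P j \<in> carrier_mat n n"
  shows "kronecker_family P \<in> carrier_mat (n ^ CARD('m)) (n ^ CARD('m))"
  using foldr_kronecker_carrier[of P n "sorted_list_of_set UNIV", OF assms]
  by (simp add: kronecker_family_def)

lemma kronecker_family_inverse:
  fixes P Q :: "'m::{finite,linorder} \<Rightarrow> 'a::comm_semiring_1 mat"
  assumes "\<And>j. P j \<in> carrier_mat n n" "\<And>j. Q j \<in> carrier_mat n n" "\<And>j. Q j * P j = 1\<^sub>m n"
  shows "kronecker_family Q * kronecker_family P = 1\<^sub>m (n ^ CARD('m))"
  using foldr_kronecker_inverse[of P n Q "sorted_list_of_set UNIV", OF assms]
  by (simp add: kronecker_family_def)

lemma mat_trace_commute:
  fixes A B :: "'a::comm_semiring_1 mat"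
  assumes A: "A \<in> carrier_mat n m" and B: "B \<in> carrier_mat m n"
  shows "mat_trace (A * B) = mat_trace (B * A)"
proof -
  have "mat_trace (A * B) = (\<Sum>i<n. \<Sum>p<m. A $$ (i, p) * B $$ (p, i))"
    using A by (auto simp: mat_trace_def mat_mult_index[OF A B] simp del: index_mult_mat(1))
  also have "\<dots> = (\<Sum>p<m. \<Sum>i<n. B $$ (p, i) * A $$ (i, p))"
    by (subst sum.swap) (simp add: mult.commute)
  also have "\<dots> = mat_trace (B * A)"
    using B by (auto simp: mat_trace_def mat_mult_index[OF B A] simp del: index_mult_mat(1))
  finally show ?thesis .
qed

text \<open>
  The digits of \<open>k < n ^ m\<close> to base \<open>n\<close> determine \<open>k\<close>, so the map is injective; surjectivity follows by
  counting. The number of larger indices takes each value below \<open>m\<close> exactly once, so every digit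
  occurs.
\<close>

lemma lex_index_bij_betw:
  assumes "n > 0"
  shows "bij_betw (lex_index n :: nat \<Rightarrow> 'm::{finite,linorder} \<Rightarrow> nat)
    {..<n ^ CARD('m)} (PiE UNIV (\<lambda>_. {..<n}))"
proof -
  let ?r = "\<lambda>j::'m. card {i. j < i}"
  have mono: "?r b < ?r a" if "a < b" for a b
    using that by (intro psubset_card_mono) auto
  have "inj ?r"
    by (rule injI) (metis mono linorder_neqE less_irrefl)
  moreover have "range ?r \<subseteq> {..<CARD('m)}"
    by (auto intro!: psubset_card_mono)
  ultimately have rank: "range ?r = {..<CARD('m)}"
    by (intro card_subset_eq) (auto simp: card_image)
  have inj: "inj_on (lex_index n :: nat \<Rightarrow> 'm \<Rightarrow> nat) {..<n ^ CARD('m)}"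
  proof (rule inj_onI)
    fix x y assume xy: "x \<in> {..<n ^ CARD('m)}" "y \<in> {..<n ^ CARD('m)}"
      and eq: "lex_index n x = (lex_index n y :: 'm \<Rightarrow> nat)"
    have digit: "x div n ^ t mod n = y div n ^ t mod n" if "t < CARD('m)" for t
    proof -
      obtain j :: 'm where "t = ?r j" using rank \<open>t < CARD('m)\<close> by blast
      then show ?thesis using fun_cong[OF eq, of j] by (simp add: lex_index_def)
    qed
    \<comment> \<open>Going from modulus \<open>n ^ t\<close> to \<open>n ^ Suc t\<close> adds one digit, from the lowest on.\<close>
    have "x mod n ^ t = y mod n ^ t" if "t \<le> CARD('m)" for t
      using that
    proof (induction t)
      case (Suc t)
      then show ?case
        using digit[of t] mod_mult2_eq[of x "n ^ t" n] mod_mult2_eq[of y "n ^ t" n]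
        by (simp add: mult.commute)
    qed simp
    from this[of "CARD('m)"] show "x = y" using xy by simp
  qed
  moreover have "lex_index n ` {..<n ^ CARD('m)} = (PiE UNIV (\<lambda>_. {..<n}) :: ('m \<Rightarrow> nat) set)"
  proof (rule card_subset_eq)
    show "card (lex_index n ` {..<n ^ CARD('m)} :: ('m \<Rightarrow> nat) set) = card (PiE UNIV (\<lambda>_. {..<n}) :: ('m \<Rightarrow> nat) set)"
      using inj by (simp add: card_image card_PiE)
    show "finite (PiE UNIV (\<lambda>_. {..<n}) :: ('m \<Rightarrow> nat) set)"
      by (intro finite_PiE) auto
  qed (use assms in \<open>auto simp: lex_index_def\<close>)
  ultimately show ?thesis by (simp add: bij_betw_def)
qed

lemma char_poly_diagonalized:
  fixes A :: "'a::field mat"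
  assumes "A \<in> carrier_mat n n" "similar_mat_wit A (mat_diag n d) P Q"
  shows "char_poly A = (\<Prod>k\<leftarrow>[0..<n]. [:- d k, 1:])"
proof -
  have "diag_mat (mat_diag n d) = map d [0..<n]"
    by (auto simp: diag_mat_def mat_diag_def)
  moreover have "upper_triangular (mat_diag n d)" by (auto simp: mat_diag_def)
  moreover have "char_poly A = char_poly (mat_diag n d)"
    using assms by (intro char_poly_similar) (auto simp: similar_mat_def)
  ultimately show ?thesis
    by (simp add: char_poly_upper_triangular[OF mat_diag_dim] o_def)
qed

text \<open>
  Cyclicity of the trace brings the two Kronecker products next to each other, where they cancel.
\<close>

lemma mat_trace_matrix_ext_value:
  fixes f :: "real ^ 'm::{finite,linorder} \<Rightarrow> real"
  assumes n: "n > 0" and M: "\<And>j. M j \<in> carrier_mat n n"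
    and X: "X = kronecker_family P * mat_diag (n ^ CARD('m))
              (\<lambda>k. complex_of_real (f (\<chi> j. l j (lex_index n k j)))) * kronecker_family Q"
    and sim: "\<And>j. similar_mat_wit (M j) (mat_diag n (\<lambda>k. complex_of_real (l j k))) (P j) (Q j)"
  shows "mat_trace X = complex_of_real (\<Sum>i\<in>PiE UNIV (\<lambda>_. {..<n}). f (\<chi> j. l j (i j)))"
proof -
  let ?N = "n ^ CARD('m)"
  let ?d = "\<lambda>k. complex_of_real (f (\<chi> j. l j (lex_index n k j)))"
  note s = similar_mat_witD2[OF M sim]
  have P: "kronecker_family P \<in> carrier_mat ?N ?N" and Q: "kronecker_family Q \<in> carrier_mat ?N ?N"
    using s by (auto intro!: kronecker_family_carrier)
  have "mat_trace X = mat_trace (kronecker_family Q * (kronecker_family P * mat_diag ?N ?d))"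
    unfolding X using P Q by (intro mat_trace_commute[of _ ?N ?N]) auto
  also have "kronecker_family Q * (kronecker_family P * mat_diag ?N ?d) =
      kronecker_family Q * kronecker_family P * mat_diag ?N ?d"
    using P Q by (simp add: assoc_mult_mat[of _ ?N ?N _ ?N _ ?N])
  also have "\<dots> = mat_diag ?N ?d"
    using s by (simp add: kronecker_family_inverse[of P n Q] left_mult_one_mat[OF mat_diag_dim])
  also have "mat_trace (mat_diag ?N ?d) = (\<Sum>k<?N. ?d k)"
    by (simp add: mat_trace_def mat_diag_def)
  also have "\<dots> = complex_of_real (\<Sum>k<?N. f (\<chi> j. l j (lex_index n k j)))" by simp
  also have "(\<Sum>k<?N. f (\<chi> j. l j (lex_index n k j))) =
      (\<Sum>i\<in>PiE UNIV (\<lambda>_. {..<n}). f (\<chi> j. l j (i j)))"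
    by (rule sum.reindex_bij_betw[OF lex_index_bij_betw[OF n]])
  finally show ?thesis .
qed

text \<open>
  Two factorizations into linear factors have the same multiset of roots; equal multisets of
  enumerated values differ by a permutation of the enumeration.
\<close>

lemma linear_factors_permutation:
  fixes l l' :: "nat \<Rightarrow> real"
  assumes "(\<Prod>k\<leftarrow>[0..<n]. [:- complex_of_real (l k), 1:]) = (\<Prod>k\<leftarrow>[0..<n]. [:- complex_of_real (l' k), 1:])"
  obtains p where "p permutes {..<n}" "\<And>k. k < n \<Longrightarrow> l' k = l (p k)"
proof -
  have roots: "proots (\<Prod>k\<leftarrow>xs. [:- complex_of_real (h k), 1:]) = mset (map (complex_of_real \<circ> h) xs)"
    for h :: "nat \<Rightarrow> real" and xs
  proof (induction xs)
    case (Cons k xs)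
    have "(\<Prod>k\<leftarrow>xs. [:- complex_of_real (h k), 1:]) \<noteq> 0"
      by (auto simp: prod_list_zero_iff)
    then show ?case using Cons by (simp add: proots_mult del: mult_pCons_left)
  qed simp
  have "mset (map (complex_of_real \<circ> l') [0..<n]) = mset (map (complex_of_real \<circ> l) [0..<n])"
    using arg_cong[OF assms, of proots] unfolding roots by simp
  then obtain p where p: "p permutes {..<length (map (complex_of_real \<circ> l) [0..<n])}"
    "permute_list p (map (complex_of_real \<circ> l) [0..<n]) = map (complex_of_real \<circ> l') [0..<n]"
    by (rule mset_eq_permutation)
  then have pn: "p permutes {..<n}" by simp
  have "l' k = l (p k)" if "k < n" for k
    using arg_cong[OF p(2), of "\<lambda>xs. xs ! k"] permute_list_nth[OF p(1), of k] that
      permutes_in_image[OF pn, of k] by simp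
  with pn show ?thesis by (rule that)
qed

text \<open>
  The chosen value of the matrix function may come from other diagonalizations than the given ones.
  Both list the roots of the same characteristic polynomial, so they differ by a permutation for each
  \<open>j\<close>, which only reorders the sum.
\<close>

lemma mat_trace_matrix_ext:
  fixes f :: "real ^ 'm::{finite,linorder} \<Rightarrow> real"
  assumes n: "n > 0" and M: "\<And>j. M j \<in> carrier_mat n n"
    and sim: "\<And>j. similar_mat_wit (M j) (mat_diag n (\<lambda>k. complex_of_real (l j k))) (P j) (Q j)"
  shows "mat_trace (matrix_ext n f M) =
    complex_of_real (\<Sum>i\<in>PiE UNIV (\<lambda>_. {..<n}). f (\<chi> j. l j (i j)))"
proof -
  have "\<exists>X. is_matrix_ext n f M X"
    using M sim unfolding is_matrix_ext_def by blast
  then have "is_matrix_ext n f M (matrix_ext n f M)"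
    unfolding matrix_ext_def by (rule someI_ex)
  then obtain P' Q' l' where
    sim': "\<And>j. similar_mat_wit (M j) (mat_diag n (\<lambda>k. complex_of_real (l' j k))) (P' j) (Q' j)" and
    X: "matrix_ext n f M = kronecker_family P' * mat_diag (n ^ CARD('m))
              (\<lambda>k. complex_of_real (f (\<chi> j. l' j (lex_index n k j)))) * kronecker_family Q'"
    unfolding is_matrix_ext_def by blast
  have "\<exists>p. p permutes {..<n} \<and> (\<forall>k<n. l' j k = l j (p k))" for j
  proof -
    from linear_factors_permutation[where n = n and l = "l j" and l' = "l' j"]
      char_poly_diagonalized[OF M sim, of j] char_poly_diagonalized[OF M sim', of j]
    show ?thesis by metis
  qed
  then obtain p where p: "\<And>j. p j permutes {..<n}" "\<And>j k. k < n \<Longrightarrow> l' j k = l j (p j k)"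
    by metis
  have bij: "bij_betw (\<lambda>i j. p j (i j)) (PiE UNIV (\<lambda>_. {..<n})) (PiE UNIV (\<lambda>_. {..<n}))"
  proof (rule bij_betwI[of _ _ _ "\<lambda>i j. inv_into UNIV (p j) (i j)"])
    fix i
    show "(\<lambda>j. inv_into UNIV (p j) (p j (i j))) = i" "(\<lambda>j. p j (inv_into UNIV (p j) (i j))) = i"
      using permutes_inverses[OF p(1)] by auto
  qed (use permutes_in_image[OF p(1)] permutes_in_image[OF permutes_inv[OF p(1)]] in
      \<open>auto simp: PiE_def Pi_def\<close>)
  have "mat_trace (matrix_ext n f M) =
      complex_of_real (\<Sum>i\<in>PiE UNIV (\<lambda>_. {..<n}). f (\<chi> j. l' j (i j)))"
    using mat_trace_matrix_ext_value[OF n M X sim'] .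
  also have "(\<Sum>i\<in>PiE UNIV (\<lambda>_. {..<n}). f (\<chi> j. l' j (i j))) =
      (\<Sum>i\<in>PiE UNIV (\<lambda>_. {..<n}). f (\<chi> j. l j (p j (i j))))"
    using p(2) by (intro sum.cong refl) (auto simp: PiE_def Pi_def)
  also have "\<dots> = (\<Sum>i\<in>PiE UNIV (\<lambda>_. {..<n}). f (\<chi> j. l j (i j)))"
    by (rule sum.reindex_bij_betw[OF bij])
  finally show ?thesis .
qed

section \<open>Eigenvalues of a combination of Hermitian matrices\<close>

definition doubly_stochastic :: "nat \<Rightarrow> (nat \<Rightarrow> nat \<Rightarrow> real) \<Rightarrow> bool" where
  "doubly_stochastic n d \<longleftrightarrow> (\<forall>k<n. \<forall>p<n. 0 \<le> d k p) \<and>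
     (\<forall>k<n. (\<Sum>p<n. d k p) = 1) \<and> (\<forall>p<n. (\<Sum>k<n. d k p) = 1)"

text \<open>
  The rows and the columns of a unitary matrix are unit vectors.
\<close>

lemma doubly_stochastic_unitary:
  assumes "unitary n G"
  shows "doubly_stochastic n (\<lambda>k p. (cmod (G $$ (k, p)))\<^sup>2)"
proof -
  note G = unitaryD[OF assms]
  have row: "(\<Sum>p<n. (cmod (G $$ (k, p)))\<^sup>2) = 1" if k: "k < n" for k
  proof -
    have "complex_of_real (\<Sum>p<n. (cmod (G $$ (k, p)))\<^sup>2) = (G * mat_adjoint G) $$ (k, k)"
      unfolding mat_mult_index[OF G(1,2) k k] of_real_sum
      using k by (intro sum.cong refl) (simp add: mat_adjoint_index[OF G(1)] complex_norm_square flip: of_real_power)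
    also have "\<dots> = complex_of_real 1" using k G(4) by simp
    finally show ?thesis by (simp only: of_real_eq_iff)
  qed
  have col: "(\<Sum>k<n. (cmod (G $$ (k, p)))\<^sup>2) = 1" if p: "p < n" for p
  proof -
    have "complex_of_real (\<Sum>k<n. (cmod (G $$ (k, p)))\<^sup>2) = (mat_adjoint G * G) $$ (p, p)"
      unfolding mat_mult_index[OF G(2,1) p p] of_real_sum
      using p by (intro sum.cong refl)
        (simp add: mat_adjoint_index[OF G(1)] complex_norm_square mult.commute flip: of_real_power)
    also have "\<dots> = complex_of_real 1" using p G(3) by simp
    finally show ?thesis by (simp only: of_real_eq_iff)
  qed
  show ?thesis using row col by (simp add: doubly_stochastic_def)
qed

text \<open>
  The squared modulus of the inner product of column \<open>k\<close> of \<open>U\<close> with column \<open>p\<close> of \<open>V\<close>.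
\<close>

definition overlap :: "complex mat \<Rightarrow> complex mat \<Rightarrow> nat \<Rightarrow> nat \<Rightarrow> real" where
  "overlap U V k p = (cmod ((mat_adjoint U * V) $$ (k, p)))\<^sup>2"

lemma doubly_stochastic_overlap:
  assumes "unitary n U" "unitary n V"
  shows "doubly_stochastic n (overlap U V)"
  unfolding overlap_def
  by (intro doubly_stochastic_unitary unitary_mult unitary_adjoint assms)

text \<open>
  With \<open>G = mat_adjoint U * V\<close> the matrix of \<open>M\<close> in the basis \<open>U\<close> is \<open>G D mat_adjoint G\<close> with \<open>D\<close>
  the diagonal matrix of the \<open>\<mu> p\<close>.
\<close>

lemma diagonal_in_other_eigenbasis:
  assumes U: "unitary n U" and M: "diagonalizes n M V \<mu>" and k: "k < n"
  shows "(mat_adjoint U * M * U) $$ (k, k) = complex_of_real (\<Sum>p<n. overlap U V k p * \<mu> p)"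
proof -
  define D where "D = mat_diag n (\<lambda>k. complex_of_real (\<mu> k))"
  have D: "D \<in> carrier_mat n n" by (simp add: D_def)
  have V: "unitary n V" and M: "M = V * D * mat_adjoint V"
    using M by (auto simp: diagonalizes_def D_def)
  define G where "G = mat_adjoint U * V"
  have uG: "unitary n G" unfolding G_def by (intro unitary_mult unitary_adjoint U V)
  note u = unitaryD[OF U] and v = unitaryD[OF V] and g = unitaryD[OF uG]
  have adjG: "mat_adjoint G = mat_adjoint V * U"
    unfolding G_def mat_adjoint_mult[OF u(2) v(1)] mat_adjoint_adjoint[OF u(1)] ..
  have eq: "mat_adjoint U * M * U = G * D * mat_adjoint G"
    unfolding adjG unfolding G_def M using u(1,2) v(1,2) D
    by (simp add: assoc_mult_mat[of _ n n _ n _ n])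
  have GD: "(G * D) $$ (k, p) = G $$ (k, p) * complex_of_real (\<mu> p)" if "p < n" for p
    unfolding D_def mat_diag_mult_right[OF g(1)] using that k by simp
  show ?thesis
    unfolding eq mat_mult_index[OF mult_carrier_mat[OF g(1) D] g(2) k k] of_real_sum overlap_def
      G_def[symmetric]
    using k by (intro sum.cong refl)
      (simp add: GD mat_adjoint_index[OF g(1)] complex_norm_square mult_ac flip: of_real_power)
qed

lemma diagonal_in_own_eigenbasis:
  assumes A: "diagonalizes n A U a" and k: "k < n"
  shows "(mat_adjoint U * A * U) $$ (k, k) = complex_of_real (a k)"
proof -
  have U: "unitary n U" using A by (simp add: diagonalizes_def)
  have "overlap U U k p = (if p = k then 1 else 0)" if "p < n" for p
    using that k unitaryD(3)[OF U] by (simp add: overlap_def)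
  then have "(\<Sum>p<n. overlap U U k p * a p) = (\<Sum>p<n. if p = k then a p else 0)"
    by (intro sum.cong) auto
  then show ?thesis
    using diagonal_in_other_eigenbasis[OF U A k] k by simp
qed

text \<open>
  The eigenvalues of the combination are its diagonal entries in its own eigenbasis \<open>U\<close>, and
  diagonal entries are linear in the matrix. So they are combinations of the diagonal entries of \<open>M\<close>
  and \<open>N\<close> in the basis \<open>U\<close>, which are averages of the eigenvalues of \<open>M\<close> and of \<open>N\<close>.
\<close>

lemma eigenvalues_of_combination:
  assumes A: "diagonalizes n (complex_of_real \<alpha> \<cdot>\<^sub>m M + complex_of_real \<beta> \<cdot>\<^sub>m N) U a"
    (is "diagonalizes n ?A U a")
    and M: "diagonalizes n M V \<mu>" and N: "diagonalizes n N W \<nu>" and k: "k < n"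
  shows "a k = \<alpha> * (\<Sum>p<n. overlap U V k p * \<mu> p) + \<beta> * (\<Sum>p<n. overlap U W k p * \<nu> p)"
proof -
  have U: "unitary n U" using A by (simp add: diagonalizes_def)
  note u = unitaryD[OF U] and Mc = diagonalizes_carrier[OF M] and Nc = diagonalizes_carrier[OF N]
  have lin: "mat_adjoint U * ?A * U = complex_of_real \<alpha> \<cdot>\<^sub>m (mat_adjoint U * M * U)
      + complex_of_real \<beta> \<cdot>\<^sub>m (mat_adjoint U * N * U)"
    using u(1,2) Mc Nc
    by (simp add: mult_add_distrib_mat[of _ n n _ n] add_mult_distrib_mat[of _ n n _ _ n]
        mult_smult_distrib[of _ n n _ n] mult_smult_assoc_mat[of _ n n _ n])
  have "complex_of_real (a k) = (mat_adjoint U * ?A * U) $$ (k, k)"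
    by (rule diagonal_in_own_eigenbasis[OF A k, symmetric])
  also have "\<dots> = complex_of_real \<alpha> * (mat_adjoint U * M * U) $$ (k, k)
      + complex_of_real \<beta> * (mat_adjoint U * N * U) $$ (k, k)"
    unfolding lin using u(1,2) Mc Nc k by (simp del: index_mult_mat(1))
  also have "\<dots> = complex_of_real (\<alpha> * (\<Sum>p<n. overlap U V k p * \<mu> p)
      + \<beta> * (\<Sum>p<n. overlap U W k p * \<nu> p))"
    by (simp only: diagonal_in_other_eigenbasis[OF U M k] diagonal_in_other_eigenbasis[OF U N k]
        of_real_mult of_real_add)
  finally show ?thesis by (simp only: of_real_eq_iff)
qed

section \<open>Convexity of the trace\<close>

text \<open>
  A form of the easy half of Karamata's inequality, in each of several variables at once. The weights
  \<open>w i p\<close>, products of entries of the \<open>d j\<close>, are again doubly stochastic, and the row of \<open>i\<close>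
  averages the \<open>j\<close>-th coordinate as the row of \<open>i j\<close> in \<open>d j\<close> does, because the other factors sum
  to one.
\<close>

lemma sum_doubly_stochastic_le:
  fixes f :: "real ^ 'm::finite \<Rightarrow> real"
  assumes conv: "convex_on (set_prod S) f" and n: "n > 0"
    and d: "\<And>j. doubly_stochastic n (d j)" and \<mu>: "\<And>j p. p < n \<Longrightarrow> \<mu> j p \<in> S j"
  shows "(\<Sum>i\<in>PiE UNIV (\<lambda>_. {..<n}). f (\<chi> j. \<Sum>p<n. d j (i j) p * \<mu> j p))
    \<le> (\<Sum>i\<in>PiE UNIV (\<lambda>_. {..<n}). f (\<chi> j. \<mu> j (i j)))"
proof -
  let ?I = "PiE UNIV (\<lambda>_. {..<n}) :: ('m \<Rightarrow> nat) set"
  have fin: "finite ?I" by (intro finite_PiE) auto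
  have ne: "?I \<noteq> {}" using n by (auto simp: PiE_eq_empty_iff)
  have lt: "i j < n" if "i \<in> ?I" for i j using that by auto
  let ?w = "\<lambda>i p. \<Prod>j\<in>UNIV. d j (i j) (p j)"
  have w_nonneg: "0 \<le> ?w i p" if "i \<in> ?I" "p \<in> ?I" for i p
    using d lt[OF that(1)] lt[OF that(2)] by (auto intro!: prod_nonneg simp: doubly_stochastic_def)
  have w_row: "(\<Sum>p\<in>?I. ?w i p) = 1" if "i \<in> ?I" for i
    using d lt[OF that] prod_sum_PiE[of "UNIV :: 'm set" "\<lambda>_. {..<n}" "\<lambda>j. d j (i j)"]
    by (simp add: doubly_stochastic_def)
  have w_col: "(\<Sum>i\<in>?I. ?w i p) = 1" if "p \<in> ?I" for p
    using d lt[OF that] prod_sum_PiE[of "UNIV :: 'm set" "\<lambda>_. {..<n}" "\<lambda>j k. d j k (p j)"]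
    by (simp add: doubly_stochastic_def)
  have mean: "(\<Sum>p\<in>?I. ?w i p * \<mu> j (p j)) = (\<Sum>p<n. d j (i j) p * \<mu> j p)"
    if i: "i \<in> ?I" for i j
  proof -
    \<comment> \<open>The coordinate enters as an additional factor at index \<open>j\<close>, so that the sum of products is a
        product of sums.\<close>
    have "(\<Sum>p\<in>?I. ?w i p * \<mu> j (p j)) =
        (\<Sum>p\<in>?I. \<Prod>h\<in>UNIV. d h (i h) (p h) * (if h = j then \<mu> h (p h) else 1))"
      by (simp add: prod.distrib)
    also have "\<dots> = (\<Prod>h\<in>UNIV. \<Sum>p<n. d h (i h) p * (if h = j then \<mu> h p else 1))"
      by (rule prod_sum_PiE[symmetric]) auto
    also have "\<dots> = (\<Prod>h\<in>UNIV. if h = j then \<Sum>p<n. d h (i h) p * \<mu> h p else 1)"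
      using d lt[OF i] by (intro prod.cong) (auto simp: doubly_stochastic_def)
    also have "\<dots> = (\<Sum>p<n. d j (i j) p * \<mu> j p)" by simp
    finally show ?thesis .
  qed
  have jensen: "f (\<chi> j. \<Sum>p<n. d j (i j) p * \<mu> j p) \<le> (\<Sum>p\<in>?I. ?w i p * f (\<chi> j. \<mu> j (p j)))"
    if i: "i \<in> ?I" for i
  proof -
    have "(\<chi> j. \<Sum>p<n. d j (i j) p * \<mu> j p) = (\<Sum>p\<in>?I. ?w i p *\<^sub>R (\<chi> j. \<mu> j (p j)))"
      by (simp add: Finite_Cartesian_Product.vec_eq_iff mean[OF i])
    also have "f \<dots> \<le> (\<Sum>p\<in>?I. ?w i p * f (\<chi> j. \<mu> j (p j)))"
      using fin ne conv w_row[OF i] w_nonneg[OF i] \<mu> lt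
      by (intro convex_on_sum) (auto simp: set_prod_def)
    finally show ?thesis .
  qed
  have "(\<Sum>i\<in>?I. f (\<chi> j. \<Sum>p<n. d j (i j) p * \<mu> j p))
      \<le> (\<Sum>i\<in>?I. \<Sum>p\<in>?I. ?w i p * f (\<chi> j. \<mu> j (p j)))"
    by (intro sum_mono jensen)
  also have "\<dots> = (\<Sum>p\<in>?I. (\<Sum>i\<in>?I. ?w i p) * f (\<chi> j. \<mu> j (p j)))"
    by (subst sum.swap) (simp add: sum_distrib_right)
  also have "\<dots> = (\<Sum>p\<in>?I. f (\<chi> j. \<mu> j (p j)))"
    by (intro sum.cong refl) (simp add: w_col)
  finally show ?thesis .
qed

lemma doubly_stochastic_mean_in:
  assumes "convex S" "doubly_stochastic n d" "\<And>p. p < n \<Longrightarrow> \<mu> p \<in> S" "k < n"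
  shows "(\<Sum>p<n. d k p * \<mu> p) \<in> S"
  using convex_sum[of "{..<n}" S "d k" \<mu>] assms by (auto simp: doubly_stochastic_def)

text \<open>
  Membership is stated for the eigenvalues of \<open>A\<close>; the diagonal entries are such, being roots of the
  characteristic polynomial.
\<close>

lemma M_herm_diagonalization:
  assumes "A \<in> M_herm n S"
  obtains U l where "diagonalizes n A U l" "\<And>k. k < n \<Longrightarrow> l k \<in> S"
proof -
  have A: "A \<in> carrier_mat n n" "hermitian A" and ev: "\<And>c. eigenvalue A c \<Longrightarrow> c \<in> complex_of_real ` S"
    using assms by (auto simp: M_herm_def)
  obtain U l where U: "diagonalizes n A U l"
    using hermitian_diagonalizable[OF A] .
  have "l k \<in> S" if "k < n" for k
  proof -
    have "poly (char_poly A) (complex_of_real (l k)) = 0"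
      unfolding char_poly_diagonalized[OF A(1) diagonalizes_similar[OF U]] using that
      by (auto simp: poly_prod_list prod_list_zero_iff)
    then have "complex_of_real (l k) \<in> complex_of_real ` S"
      using ev eigenvalue_root_char_poly[OF A(1)] by blast
    then show ?thesis by auto
  qed
  with U show ?thesis by (rule that)
qed

lemma hermitian_combination:
  assumes "A \<in> carrier_mat n n" "hermitian A" "B \<in> carrier_mat n n" "hermitian B"
  shows "hermitian (complex_of_real a \<cdot>\<^sub>m A + complex_of_real b \<cdot>\<^sub>m B)" (is "hermitian ?C")
proof -
  have C: "?C \<in> carrier_mat n n" using assms by auto
  have "mat_adjoint ?C = ?C"
  proof (rule eq_matI)
    fix i j assume "i < dim_row ?C" "j < dim_col ?C"
    then have ij: "i < n" "j < n" using C by auto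
    show "mat_adjoint ?C $$ (i, j) = ?C $$ (i, j)"
      unfolding mat_adjoint_index[OF C ij]
      using ij assms(1,3) hermitianD[OF assms(2,1) ij] hermitianD[OF assms(4,3) ij] by simp
  qed (use C mat_adjoint_carrier[OF C] in auto)
  then show ?thesis
    using carrier_matD[OF C] unfolding hermitian_def square_mat.simps by metis
qed

lemma mat_trace_matrix_ext_convex:
  fixes f :: "real ^ 'm::{finite,linorder} \<Rightarrow> real"
  assumes n: "n > 0" and S: "\<And>j. convex (S j)" and f: "convex_on (set_prod S) f"
    and \<alpha>: "0 \<le> \<alpha>" "\<alpha> \<le> 1"
    and M: "\<And>j. M j \<in> M_herm n (S j)" and N: "\<And>j. N j \<in> M_herm n (S j)"
  shows "mat_trace (matrix_ext n f (\<lambda>j. complex_of_real \<alpha> \<cdot>\<^sub>m M j + complex_of_real (1 - \<alpha>) \<cdot>\<^sub>m N j))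
    \<le> complex_of_real \<alpha> * mat_trace (matrix_ext n f M)
      + complex_of_real (1 - \<alpha>) * mat_trace (matrix_ext n f N)"
proof -
  have Mc: "M j \<in> carrier_mat n n" and Nc: "N j \<in> carrier_mat n n" for j
    using M[of j] N[of j] by (auto simp: M_herm_def)
  let ?A = "\<lambda>j. complex_of_real \<alpha> \<cdot>\<^sub>m M j + complex_of_real (1 - \<alpha>) \<cdot>\<^sub>m N j"
  have Ac: "?A j \<in> carrier_mat n n" and Ah: "hermitian (?A j)" for j
    using Mc[of j] Nc[of j] M[of j] N[of j] hermitian_combination[OF Mc[of j] _ Nc[of j], of \<alpha> "1 - \<alpha>"]
    by (auto simp only: M_herm_def intro!: add_carrier_mat smult_carrier_mat)
  have "\<exists>U l. diagonalizes n (?A j) U l" for j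
    using hermitian_diagonalizable[OF Ac Ah] by blast
  then obtain U a where A: "\<And>j. diagonalizes n (?A j) (U j) (a j)" by metis
  have "\<exists>V l. diagonalizes n (M j) V l \<and> (\<forall>k<n. l k \<in> S j)" for j
    using M_herm_diagonalization[OF M] by metis
  then obtain V \<mu> where M_diag: "\<And>j. diagonalizes n (M j) (V j) (\<mu> j)"
    and \<mu>: "\<And>j k. k < n \<Longrightarrow> \<mu> j k \<in> S j"
    by metis
  have "\<exists>W l. diagonalizes n (N j) W l \<and> (\<forall>k<n. l k \<in> S j)" for j
    using M_herm_diagonalization[OF N] by metis
  then obtain W \<nu> where N_diag: "\<And>j. diagonalizes n (N j) (W j) (\<nu> j)"
    and \<nu>: "\<And>j k. k < n \<Longrightarrow> \<nu> j k \<in> S j"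
    by metis
  let ?d = "\<lambda>j. overlap (U j) (V j)" and ?e = "\<lambda>j. overlap (U j) (W j)"
  have d: "doubly_stochastic n (?d j)" and e: "doubly_stochastic n (?e j)" for j
    using A[of j] M_diag[of j] N_diag[of j]
    by (auto simp: diagonalizes_def intro!: doubly_stochastic_overlap)
  note a = eigenvalues_of_combination[OF A M_diag N_diag]
  let ?I = "PiE UNIV (\<lambda>_. {..<n}) :: ('m \<Rightarrow> nat) set"
  let ?b = "\<lambda>i. \<chi> j. \<Sum>p<n. ?d j (i j) p * \<mu> j p" and ?c = "\<lambda>i. \<chi> j. \<Sum>p<n. ?e j (i j) p * \<nu> j p"
  have "f (\<chi> j. a j (i j)) \<le> \<alpha> * f (?b i) + (1 - \<alpha>) * f (?c i)" if i: "i \<in> ?I" for i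
  proof -
    have lt: "i j < n" for j using i by auto
    have "(\<chi> j. a j (i j)) = \<alpha> *\<^sub>R ?b i + (1 - \<alpha>) *\<^sub>R ?c i"
      by (simp add: Finite_Cartesian_Product.vec_eq_iff a[OF lt])
    moreover have "?b i \<in> set_prod S" "?c i \<in> set_prod S"
      using doubly_stochastic_mean_in[OF S d \<mu> lt] doubly_stochastic_mean_in[OF S e \<nu> lt]
      by (auto simp: set_prod_def)
    ultimately show ?thesis using f \<alpha> by (simp add: convex_on_def)
  qed
  then have "(\<Sum>i\<in>?I. f (\<chi> j. a j (i j))) \<le> (\<Sum>i\<in>?I. \<alpha> * f (?b i) + (1 - \<alpha>) * f (?c i))"
    by (rule sum_mono)
  also have "\<dots> = \<alpha> * (\<Sum>i\<in>?I. f (?b i)) + (1 - \<alpha>) * (\<Sum>i\<in>?I. f (?c i))"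
    by (simp only: sum.distrib sum_distrib_left)
  also have "\<dots> \<le> \<alpha> * (\<Sum>i\<in>?I. f (\<chi> j. \<mu> j (i j))) + (1 - \<alpha>) * (\<Sum>i\<in>?I. f (\<chi> j. \<nu> j (i j)))"
    using \<alpha> by (intro add_mono mult_left_mono sum_doubly_stochastic_le[OF f n] d e \<mu> \<nu>) auto
  finally show ?thesis
    unfolding mat_trace_matrix_ext[OF n Ac diagonalizes_similar[OF A]]
      mat_trace_matrix_ext[OF n Mc diagonalizes_similar[OF M_diag]]
      mat_trace_matrix_ext[OF n Nc diagonalizes_similar[OF N_diag]]
    by (simp add: less_eq_complex_def)
qed

text \<open>
  The chosen values for \<open>f\<close> and \<open>- f\<close> may come from different diagonalizations, so the sign is
  compared on the sums over the eigenvalues.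
\<close>

lemma mat_trace_matrix_ext_uminus:
  fixes f :: "real ^ 'm::{finite,linorder} \<Rightarrow> real"
  assumes n: "n > 0" and M: "\<And>j. M j \<in> carrier_mat n n" and h: "\<And>j. hermitian (M j)"
  shows "mat_trace (matrix_ext n (\<lambda>x. - f x) M) = - mat_trace (matrix_ext n f M)"
proof -
  have "\<exists>U l. diagonalizes n (M j) U l" for j
    using hermitian_diagonalizable[OF M h] by blast
  then obtain U l where U: "\<And>j. diagonalizes n (M j) (U j) (l j)" by metis
  show ?thesis
    unfolding mat_trace_matrix_ext[OF n M diagonalizes_similar[OF U]] by (simp add: sum_negf)
qed

theorem proposition2p4:
  fixes n :: nat
    and S :: "'m::{finite,linorder} \<Rightarrow> real set"
    and f :: "real ^ 'm::{finite,linorder} \<Rightarrow> real"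
  assumes "n > 0"
    and "\<And>j. convex (S j)"
    and "continuous_on (set_prod S) f"
  shows "(convex_on (set_prod S) f \<longrightarrow>
           (\<forall>\<alpha>\<in>{0..1::real}. \<forall>M N. (\<forall>j. M j \<in> M_herm n (S j)) \<longrightarrow> (\<forall>j. N j \<in> M_herm n (S j)) \<longrightarrow>
             mat_trace (matrix_ext n f
               (\<lambda>j. complex_of_real \<alpha> \<cdot>\<^sub>m M j + complex_of_real (1 - \<alpha>) \<cdot>\<^sub>m N j))
             \<le> complex_of_real \<alpha> * mat_trace (matrix_ext n f M)
               + complex_of_real (1 - \<alpha>) * mat_trace (matrix_ext n f N)))
       \<and> (concave_on (set_prod S) f \<longrightarrow>
           (\<forall>\<alpha>\<in>{0..1::real}. \<forall>M N. (\<forall>j. M j \<in> M_herm n (S j)) \<longrightarrow> (\<forall>j. N j \<in> M_herm n (S j)) \<longrightarrow>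
             mat_trace (matrix_ext n f
               (\<lambda>j. complex_of_real \<alpha> \<cdot>\<^sub>m M j + complex_of_real (1 - \<alpha>) \<cdot>\<^sub>m N j))
             \<ge> complex_of_real \<alpha> * mat_trace (matrix_ext n f M)
               + complex_of_real (1 - \<alpha>) * mat_trace (matrix_ext n f N)))"
proof (intro conjI impI ballI allI)
  fix \<alpha> :: real and M N :: "'m \<Rightarrow> complex mat"
  assume \<alpha>: "\<alpha> \<in> {0..1}" and M: "\<forall>j. M j \<in> M_herm n (S j)" and N: "\<forall>j. N j \<in> M_herm n (S j)"
  let ?A = "\<lambda>j. complex_of_real \<alpha> \<cdot>\<^sub>m M j + complex_of_real (1 - \<alpha>) \<cdot>\<^sub>m N j"
  let ?T = "\<lambda>f M. mat_trace (matrix_ext n f M)"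
  have conv: "?T g ?A \<le> complex_of_real \<alpha> * ?T g M + complex_of_real (1 - \<alpha>) * ?T g N"
    if "convex_on (set_prod S) g" for g
    using \<alpha> M N by (intro mat_trace_matrix_ext_convex[OF assms(1,2) that]) auto
  show "?T f ?A \<le> complex_of_real \<alpha> * ?T f M + complex_of_real (1 - \<alpha>) * ?T f N"
    if "convex_on (set_prod S) f"
    using conv[OF that] .
  show "?T f ?A \<ge> complex_of_real \<alpha> * ?T f M + complex_of_real (1 - \<alpha>) * ?T f N"
    if "concave_on (set_prod S) f"
  proof -
    have M': "M j \<in> carrier_mat n n" "hermitian (M j)" and N': "N j \<in> carrier_mat n n" "hermitian (N j)" for j
      using M N by (auto simp: M_herm_def)
    have A': "?A j \<in> carrier_mat n n" "hermitian (?A j)" for j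
      using M' N' hermitian_combination[OF M' N', of \<alpha> _ "1 - \<alpha>"]
      by (auto simp only: intro!: add_carrier_mat smult_carrier_mat)
    show ?thesis
      using conv[OF that[unfolded concave_on_def]]
      unfolding mat_trace_matrix_ext_uminus[OF assms(1) M'] mat_trace_matrix_ext_uminus[OF assms(1) N']
        mat_trace_matrix_ext_uminus[OF assms(1) A']
      by (simp add: less_eq_complex_def)
  qed
qed

end
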